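(* Let $G_n$ be a depth-two claw with $n$ leaves and let $1 \leq r \leq n-1$. Then $G_n$ is $r$-EKR. Moreover, if $4 \leq r < n-1$, then $G_n$ is strictly $r$-EKR.
   Context: A depth-two claw with $n$ leaves, $G_n$, is the tree with a root $c$ adjacent to vertices $b_1,\dots,b_n$, where each $b_i$ is adjacent to exactly one further vertex $a_i$ (a leaf); equivalently a star $K_{1,n}$ with every edge subdivided. An $r$-independent set is an independent set of size $r$. A family of sets is intersecting if every two members meet. A canonically intersecting family is the family of all $r$-independent sets containing a fixed vertex. A graph is $r$-EKR if the maximum size of an intersecting family of $r$-independent sets equals the maximum size of a canonically intersecting family; it is strictly $r$-EKR if moreover every intersecting family of $r$-independent sets of maximum size is canonically intersecting. (In $G_n$ a largest canonically intersecting family is the one for a leaf, of size $\binom{n-1}{r-1}2^{r-1}+\binom{n-1}{r-2}$.) *)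

theory Defs
  imports Main
begin

text \<open>A finite simple graph is given by a vertex set V and a symmetric, irreflexive
edge relation E.\<close>

definition independent_set :: "'a set \<Rightarrow> ('a \<Rightarrow> 'a \<Rightarrow> bool) \<Rightarrow> 'a set \<Rightarrow> bool" where
  "independent_set V E S \<longleftrightarrow> S \<subseteq> V \<and> (\<forall>x\<in>S. \<forall>y\<in>S. \<not> E x y)"

definition r_independent_sets :: "'a set \<Rightarrow> ('a \<Rightarrow> 'a \<Rightarrow> bool) \<Rightarrow> nat \<Rightarrow> 'a set set" where
  "r_independent_sets V E r = {S. independent_set V E S \<and> finite S \<and> card S = r}"

definition intersecting :: "'a set set \<Rightarrow> bool" where
  "intersecting F \<longleftrightarrow> (\<forall>A\<in>F. \<forall>B\<in>F. A \<inter> B \<noteq> {})"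

definition star_family :: "'a set \<Rightarrow> ('a \<Rightarrow> 'a \<Rightarrow> bool) \<Rightarrow> nat \<Rightarrow> 'a \<Rightarrow> 'a set set" where
  "star_family V E r v = {S \<in> r_independent_sets V E r. v \<in> S}"

definition max_intersecting_size :: "'a set \<Rightarrow> ('a \<Rightarrow> 'a \<Rightarrow> bool) \<Rightarrow> nat \<Rightarrow> nat" where
  "max_intersecting_size V E r =
     Max {card F | F. F \<subseteq> r_independent_sets V E r \<and> intersecting F}"

definition max_star_size :: "'a set \<Rightarrow> ('a \<Rightarrow> 'a \<Rightarrow> bool) \<Rightarrow> nat \<Rightarrow> nat" where
  "max_star_size V E r = Max {card (star_family V E r v) | v. v \<in> V}"

definition r_EKR :: "'a set \<Rightarrow> ('a \<Rightarrow> 'a \<Rightarrow> bool) \<Rightarrow> nat \<Rightarrow> bool" where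
  "r_EKR V E r \<longleftrightarrow> max_intersecting_size V E r = max_star_size V E r"

definition strictly_r_EKR :: "'a set \<Rightarrow> ('a \<Rightarrow> 'a \<Rightarrow> bool) \<Rightarrow> nat \<Rightarrow> bool" where
  "strictly_r_EKR V E r \<longleftrightarrow> r_EKR V E r \<and>
     (\<forall>F. F \<subseteq> r_independent_sets V E r \<and> intersecting F \<and>
          card F = max_intersecting_size V E r \<longrightarrow>
          (\<exists>v\<in>V. F = star_family V E r v))"

datatype claw_vertex = Root | Mid nat | Leaf nat

definition claw_V :: "nat \<Rightarrow> claw_vertex set" where
  "claw_V n = {Root} \<union> Mid ` {..<n} \<union> Leaf ` {..<n}"

definition claw_E :: "nat \<Rightarrow> claw_vertex \<Rightarrow> claw_vertex \<Rightarrow> bool" where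
  "claw_E n x y \<longleftrightarrow> (\<exists>i<n. {x, y} = {Root, Mid i} \<or> {x, y} = {Mid i, Leaf i})"

end

theory Submission
  imports Defs "HOL-Combinatorics.Permutations"
begin

text \<open>
  Replacing \<open>Mid i\<close> by \<open>Leaf i\<close> unless the result is already present is a compression that preserves size and
  the intersection property. In a family fixed by all these compressions any two members that do
  not both contain the root share a leaf. Hence the leaf sets of the rootless members generate
  an intersecting upset \<open>U\<close> of subsets of \<open>{..<n}\<close>, and with \<open>u j\<close> the number of \<open>j\<close>-sets in \<open>U\<close> the
  size of the family is at most
  \<open>(\<Sum>j. u j * ((n - j) choose (n - r))) + (n choose (r - 1)) - u (n - r + 1)\<close>,
  with equality for the star of a leaf, where \<open>u j\<close> is \<open>(n - 1) choose (j - 1)\<close>.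
  That the star is optimal follows from \<open>u j + u (n - j) \<le> n choose j\<close> and from Katona's cycle argument:
  if \<open>2 * j \<le> n\<close> and \<open>j \<le> s \<le> n\<close>, then the ratio of \<open>u j\<close> to \<open>(n - 1) choose (j - 1)\<close> is at most that of
  \<open>u s\<close> to \<open>(n - 1) choose (s - 1)\<close>. For \<open>r \<ge> 2\<close> equality forces a singleton in \<open>U\<close>, so that the compressed
  family is the star of a leaf, and then the original family is the same star.
\<close>

section \<open>Katona's cycle argument\<close>

definition arc :: "nat \<Rightarrow> nat \<Rightarrow> nat \<Rightarrow> nat set" where
  "arc n k i = (\<lambda>t. (i + t) mod n) ` {..<k}"

text \<open>The difference of \<open>x\<close> and \<open>y\<close> is a multiple of
  \<open>n\<close> of absolute value below \<open>2 * n\<close>, hence \<open>0\<close>,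
  \<open>n\<close> or \<open>-n\<close>.\<close>

lemma mod_add_left_cancel_cases:
  fixes d x y n :: nat
  assumes "(d + x) mod n = (d + y) mod n" "x < 2 * n" "y < 2 * n"
  shows "x = y \<or> x = y + n \<or> y = x + n"
proof -
  obtain p q where "d + x + n * p = d + y + n * q"
    using assms(1) by (metis nat_mod_eq_iff)
  then have *: "int x - int y = int n * (int q - int p)"
    by (simp add: algebra_simps flip: of_nat_mult of_nat_add)
  have "\<bar>int q - int p\<bar> < 2"
  proof (rule ccontr)
    assume "\<not> ?thesis"
    then have "int n * 2 \<le> int n * \<bar>int q - int p\<bar>" by (intro mult_left_mono) auto
    also have "\<dots> = \<bar>int x - int y\<bar>" using * by (simp add: abs_mult)
    finally show False using assms by linarith
  qed
  then have "int q - int p = 0 \<or> int q - int p = 1 \<or> int q - int p = -1" by linarith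
  then show ?thesis using * by auto
qed

lemma arc_subset: "0 < n \<Longrightarrow> arc n k i \<subseteq> {..<n}"
  by (auto simp: arc_def)

lemma card_arc:
  assumes "k \<le> n"
  shows "card (arc n k i) = k"
proof -
  have "inj_on (\<lambda>t. (i + t) mod n) {..<k}"
    using mod_add_left_cancel_cases[of i _ n] assms by (fastforce intro!: inj_onI)
  then show ?thesis by (simp add: arc_def card_image)
qed

text \<open>Katona's lemma. Measured from one start in \<open>D\<close>, all other starts lie within
  distance \<open>r - 1\<close> on either side, and these positions pair up so that the two arcs of
  a pair are disjoint.\<close>

lemma card_intersecting_arcs_le:
  assumes D: "D \<subseteq> {..<n}" and r: "0 < r" "2 * r \<le> n"
    and int: "\<And>i j. i \<in> D \<Longrightarrow> j \<in> D \<Longrightarrow> arc n r i \<inter> arc n r j \<noteq> {}"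
  shows "card D \<le> r"
proof (cases "D = {}")
  case False
  then obtain d where d: "d \<in> D" by blast
  then have dn: "d < n" using D by auto
  \<comment> \<open>The clockwise distance from \<open>d\<close> to \<open>e\<close>; adding
    \<open>n - d\<close> avoids truncated subtraction.\<close>
  define off where "off e = (e + (n - d)) mod n" for e
  have off: "off e < n" "(d + off e) mod n = e" if "e \<in> D" for e
    using that D dn by (auto simp: off_def mod_simps)
  have meet: "\<exists>a<r. \<exists>b<r. off e + a = off f + b \<or> off e + a = off f + b + n \<or> off f + b = off e + a + n"
    if ef: "e \<in> D" "f \<in> D" for e f
  proof -
    obtain a b where ab: "a < r" "b < r" "(e + a) mod n = (f + b) mod n"
      using int[OF ef] by (auto simp: arc_def)
    have "(d + (off e + a)) mod n = (d + (off f + b)) mod n"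
      using ab(3) off(2)[OF ef(1)] off(2)[OF ef(2)]
      by (metis add.assoc mod_add_left_eq)
    moreover have "off e + a < 2 * n" "off f + b < 2 * n"
      using off(1)[OF ef(1)] off(1)[OF ef(2)] ab r by linarith+
    ultimately show ?thesis using mod_add_left_cancel_cases ab by blast
  qed
  have od: "off d = 0" using dn by (simp add: off_def)
  have range: "off e < r \<or> n - r < off e" if "e \<in> D" for e
    using meet[OF that d] off(1)[OF that] r unfolding od by auto
  \<comment> \<open>Offsets \<open>o\<close> and \<open>o + (n - r)\<close> are identified. The arc
    at the second ends just before the arc at the first begins, and as \<open>2 * r \<le> n\<close>
    the two are disjoint, so \<open>D\<close> contains at most one of these starts.\<close>
  define \<phi> where "\<phi> e = (if off e < r then off e else off e - (n - r))" for e
  have "inj_on \<phi> D"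
  proof (rule inj_onI)
    fix e f assume ef: "e \<in> D" "f \<in> D" "\<phi> e = \<phi> f"
    have "off e \<noteq> off f + (n - r)" "off f \<noteq> off e + (n - r)"
      using meet[OF ef(1,2)] r off(1)[OF ef(1)] off(1)[OF ef(2)] by auto
    then have "off e = off f"
      using ef(3) range[OF ef(1)] range[OF ef(2)] by (auto simp: \<phi>_def split: if_splits)
    then show "e = f" using off(2) ef by metis
  qed
  moreover have "\<phi> ` D \<subseteq> {..<r}"
    using range off(1) r by (fastforce simp: \<phi>_def)
  ultimately show ?thesis
    by (metis card_inj_on_le card_lessThan finite_lessThan)
qed simp

text \<open>A nonempty proper subset of a cycle always has a point outside it whose successor is
  inside, so each step backwards gains at least one point until the cycle is full.\<close>

lemma card_cyclic_thickening_ge: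
  assumes "D \<subseteq> {..<n}" "D \<noteq> {}"
  shows "min n (card D + k) \<le> card {i. i < n \<and> (\<exists>t\<le>k. (i + t) mod n \<in> D)}"
proof (induction k)
  case 0
  have "D \<subseteq> {i. i < n \<and> (\<exists>t\<le>0. (i + t) mod n \<in> D)}" using assms by auto
  then have "card D \<le> card {i. i < n \<and> (\<exists>t\<le>0. (i + t) mod n \<in> D)}"
    by (intro card_mono) auto
  then show ?case by simp
next
  case (Suc k)
  define S where "S k = {i. i < n \<and> (\<exists>t\<le>k. (i + t) mod n \<in> D)}" for k
  have fin: "finite (S k)" for k by (simp add: S_def)
  have sub: "S k \<subseteq> S (Suc k)" unfolding S_def using le_SucI by blast
  show ?case
  proof (cases "S k = {..<n}")
    case True
    then have "{..<n} \<subseteq> S (Suc k)" using sub by simp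
    then have "card {..<n} \<le> card (S (Suc k))" by (intro card_mono fin)
    then show ?thesis by (simp add: S_def)
  next
    case False
    have "\<exists>i<n. i \<notin> S k \<and> (i + 1) mod n \<in> S k"
    proof (rule ccontr)
      assume neg: "\<not> ?thesis"
      obtain j where j: "j < n" "j \<notin> S k" using False by (auto simp: S_def)
      \<comment> \<open>Otherwise not being in \<open>S k\<close> would propagate from
        \<open>j\<close> around the whole cycle and reach an element of \<open>D\<close>.\<close>
      have "(j + t) mod n \<notin> S k" for t
      proof (induction t)
        case (Suc t)
        then show ?case using neg j(1) by (auto simp: mod_Suc_eq dest!: spec[of _ "(j + t) mod n"])
      qed (use j in simp)
      moreover obtain d where "d \<in> D" "d < n" using assms by auto
      moreover from this have "d \<in> S k" by (force simp: S_def)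
      moreover have "(j + (d + (n - j))) mod n = d" using j \<open>d < n\<close> by simp
      ultimately show False by metis
    qed
    then obtain i where i: "i < n" "i \<notin> S k" "(i + 1) mod n \<in> S k" by blast
    have "i \<in> S (Suc k)"
    proof -
      obtain t where "t \<le> k" "((i + 1) mod n + t) mod n \<in> D" using i(3) by (auto simp: S_def)
      then have "Suc t \<le> Suc k" "(i + Suc t) mod n \<in> D" by (auto simp: mod_simps)
      then show ?thesis using i(1) unfolding S_def by blast
    qed
    then have "card (insert i (S k)) \<le> card (S (Suc k))" using sub by (intro card_mono fin) auto
    then have "Suc (card (S k)) \<le> card (S (Suc k))" using i(2) fin by simp
    then show ?thesis using Suc by (simp add: S_def)
  qed
qed

section \<open>Averaging over permutations of the cycle\<close>

lemma ex_permutes_image_eq: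
  assumes "finite X" "S \<subseteq> X" "T \<subseteq> X" "card S = card T"
  obtains p where "p permutes X" "p ` S = T"
proof -
  have fin: "finite S" "finite T" using assms finite_subset by auto
  obtain f where f: "bij_betw f S T"
    using finite_same_card_bij fin assms(4) by blast
  have "card (X - S) = card (X - T)"
    using assms fin by (simp add: card_Diff_subset)
  then obtain g where g: "bij_betw g (X - S) (X - T)"
    using finite_same_card_bij assms(1) by blast
  define p where "p x = (if x \<in> S then f x else if x \<in> X then g x else x)" for x
  have 1: "bij_betw p S T" using f by (simp add: p_def cong: bij_betw_cong)
  have 2: "bij_betw p (X - S) (X - T)"
    using g by (rule bij_betw_cong[THEN iffD1, rotated]) (auto simp: p_def)
  have "bij_betw p (S \<union> (X - S)) (T \<union> (X - T))"
    by (rule bij_betw_combine[OF 1 2]) auto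
  then have "bij_betw p X X" using assms by (simp add: Un_absorb1)
  moreover have "p x = x" if "x \<notin> X" for x using that assms by (auto simp: p_def)
  ultimately have "p permutes X" by (intro bij_imp_permutes) auto
  then show thesis using that 1 by (auto simp: bij_betw_def)
qed

text \<open>The permutations are partitioned by the image of \<open>S\<close>. Composition with a
  permutation taking \<open>T1\<close> to \<open>T2\<close> injects one class into another, so all
  \<open>card X choose card S\<close> classes have equal size.\<close>

lemma card_permutes_image_eq:
  assumes "finite X" "S \<subseteq> X" "T \<subseteq> X" "card S = card T"
  shows "card {p. p permutes X \<and> p ` S = T} * (card X choose card S) = fact (card X)"
proof -
  let ?\<T> = "{T. T \<subseteq> X \<and> card T = card S}"
  let ?N = "\<lambda>T. {p. p permutes X \<and> p ` S = T}"
  have le: "card (?N T1) \<le> card (?N T2)" if "T1 \<in> ?\<T>" "T2 \<in> ?\<T>" for T1 T2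
  proof -
    have "card T1 = card T2" using that by simp
    then obtain q where q: "q permutes X" "q ` T1 = T2"
      using ex_permutes_image_eq[OF assms(1), of T1 T2] \<open>T1 \<in> ?\<T>\<close> \<open>T2 \<in> ?\<T>\<close> by blast
    show ?thesis
    proof (rule card_inj_on_le)
      show "inj_on ((\<circ>) q) (?N T1)"
        using permutes_inj[OF q(1)] by (intro inj_onI) (simp add: fun.inj_map inj_eq)
      show "(\<circ>) q ` ?N T1 \<subseteq> ?N T2" using q by (auto simp: permutes_compose image_comp)
      show "finite (?N T2)" using finite_permutations[OF assms(1)] by (rule rev_finite_subset) auto
    qed
  qed
  have T: "T \<in> ?\<T>" using assms by simp
  have part: "{p. p permutes X} = (\<Union>T'\<in>?\<T>. ?N T')"
  proof -
    have "p ` S \<subseteq> X" if "p permutes X" for p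
      using image_mono[OF assms(2), of p] permutes_image[OF that] by simp
    then show ?thesis by (auto simp: card_image permutes_inj_on)
  qed
  have "fact (card X) = card {p. p permutes X}" using card_permutations[OF refl assms(1)] by simp
  also have "\<dots> = (\<Sum>T'\<in>?\<T>. card (?N T'))"
    unfolding part
  proof (rule card_UN_disjoint)
    show "finite ?\<T>" using assms(1) by simp
    show "\<forall>T'\<in>?\<T>. finite (?N T')"
      using finite_permutations[OF assms(1)] by (auto intro: rev_finite_subset)
  qed auto
  also have "\<dots> = (\<Sum>T'\<in>?\<T>. card (?N T))"
    using le[OF T] le[OF _ T] by (intro sum.cong) (auto intro: antisym)
  also have "\<dots> = card (?N T) * (card X choose card S)"
    using n_subsets[OF assms(1), of "card S"] by simp
  finally show ?thesis by simp
qed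

text \<open>Double counting of pairs of a permutation and a start: a fixed arc is sent to a fixed
  \<open>r\<close>-set by a fraction \<open>1 / (n choose r)\<close> of the permutations, and
  \<open>r * (n choose r) = n * ((n - 1) choose (r - 1))\<close>. The identity is cross-multiplied
  to stay within the naturals.\<close>

lemma sum_card_arcs:
  assumes W: "W \<subseteq> {S. S \<subseteq> {..<n} \<and> card S = r}" and r: "0 < r" "r \<le> n"
  shows "(\<Sum>p | p permutes {..<n}. card {i. i < n \<and> p ` arc n r i \<in> W}) * ((n - 1) choose (r - 1))
    = card W * fact n * r"
proof -
  let ?P = "{p. p permutes {..<n}}"
  have finP: "finite ?P" by (simp add: finite_permutations)
  have finW: "finite W" by (rule finite_subset[OF W]) simp
  have one: "card {p \<in> ?P. p ` arc n r i \<in> W} * (n choose r) = card W * fact n" for i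
  proof -
    have "{p \<in> ?P. p ` arc n r i \<in> W} = (\<Union>S\<in>W. {p. p permutes {..<n} \<and> p ` arc n r i = S})"
      by auto
    then have "card {p \<in> ?P. p ` arc n r i \<in> W}
        = (\<Sum>S\<in>W. card {p. p permutes {..<n} \<and> p ` arc n r i = S})"
      using finW finP by (auto intro!: card_UN_disjoint)
    moreover have "card {p. p permutes {..<n} \<and> p ` arc n r i = S} * (n choose r) = fact n"
      if "S \<in> W" for S
      using card_permutes_image_eq[of "{..<n}" "arc n r i" S] that W r
      by (auto simp: card_arc arc_subset)
    ultimately show ?thesis by (simp add: sum_distrib_right)
  qed
  have "(\<Sum>p\<in>?P. card {i. i < n \<and> p ` arc n r i \<in> W})
      = (\<Sum>p\<in>?P. \<Sum>i<n. if p ` arc n r i \<in> W then 1 else 0)"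
    by (intro sum.cong refl) (simp add: sum.If_cases Collect_conj_eq lessThan_def)
  also have "\<dots> = (\<Sum>i<n. \<Sum>p\<in>?P. if p ` arc n r i \<in> W then 1 else 0)"
    by (rule sum.swap)
  also have "\<dots> = (\<Sum>i<n. card {p \<in> ?P. p ` arc n r i \<in> W})"
    using finP by (intro sum.cong refl) (simp add: sum.If_cases Collect_conj_eq)
  finally have "(\<Sum>p\<in>?P. card {i. i < n \<and> p ` arc n r i \<in> W}) * (n choose r) = n * (card W * fact n)"
    using one by (simp add: sum_distrib_right)
  then have "r * (n choose r) * (\<Sum>p\<in>?P. card {i. i < n \<and> p ` arc n r i \<in> W}) = n * (card W * fact n * r)"
    by (simp add: algebra_simps)
  then have "n * ((\<Sum>p\<in>?P. card {i. i < n \<and> p ` arc n r i \<in> W}) * ((n - 1) choose (r - 1)))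
      = n * (card W * fact n * r)"
    unfolding times_binomial_minus1_eq[OF r(1)] by (simp add: algebra_simps)
  then show ?thesis using r by simp
qed

text \<open>For each permutation, at most \<open>r\<close> of the \<open>r\<close>-arcs land in
  \<open>W\<close>. An \<open>s\<close>-arc from \<open>i\<close> contains the \<open>r\<close>-arcs
  from \<open>i, ..., i + (s - r)\<close>, so thickening the set of good starts by
  \<open>s - r\<close> yields starts of \<open>s\<close>-arcs landing in \<open>W'\<close>. The
  resulting inequality is summed over all permutations.\<close>

lemma intersecting_upshadow:
  assumes W: "W \<subseteq> {S. S \<subseteq> {..<n} \<and> card S = r}" and int: "intersecting W"
    and W': "W' \<subseteq> {S. S \<subseteq> {..<n} \<and> card S = s}"
    and up: "\<And>S T. S \<in> W \<Longrightarrow> S \<subseteq> T \<Longrightarrow> T \<subseteq> {..<n} \<Longrightarrow> card T = s \<Longrightarrow> T \<in> W'"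
    and r: "0 < r" "2 * r \<le> n" "r \<le> s" "s \<le> n"
  shows "card W * ((n - 1) choose (s - 1)) \<le> card W' * ((n - 1) choose (r - 1))"
proof -
  let ?P = "{p. p permutes {..<n}}"
  let ?m = "\<lambda>p. card {i. i < n \<and> p ` arc n r i \<in> W}"
  let ?M = "\<lambda>p. card {i. i < n \<and> p ` arc n s i \<in> W'}"
  have each: "s * ?m p \<le> r * ?M p" if p: "p \<in> ?P" for p
  proof (cases "{i. i < n \<and> p ` arc n r i \<in> W} = {}")
    case False
    let ?D = "{i. i < n \<and> p ` arc n r i \<in> W}"
    have mr: "card ?D \<le> r"
    proof (rule card_intersecting_arcs_le[of _ n])
      fix i j assume "i \<in> ?D" "j \<in> ?D"
      then have "p ` arc n r i \<inter> p ` arc n r j \<noteq> {}"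
        using int unfolding intersecting_def by blast
      then show "arc n r i \<inter> arc n r j \<noteq> {}"
        using p by (auto simp: permutes_inj inj_eq)
    qed (use r in auto)
    have "{i. i < n \<and> (\<exists>t\<le>s - r. (i + t) mod n \<in> ?D)} \<subseteq> {i. i < n \<and> p ` arc n s i \<in> W'}"
    proof safe
      fix i t assume t: "i < n" "t \<le> s - r" "p ` arc n r ((i + t) mod n) \<in> W"
      have "arc n r ((i + t) mod n) \<subseteq> arc n s i"
      proof
        fix x assume "x \<in> arc n r ((i + t) mod n)"
        then obtain a where "a < r" "x = (i + (t + a)) mod n"
          by (auto simp: arc_def mod_simps add.assoc)
        moreover have "t + a < s" using t \<open>a < r\<close> r by linarith
        ultimately show "x \<in> arc n s i" by (auto simp: arc_def)
      qed
      moreover have "arc n s i \<subseteq> {..<n}" using t by (intro arc_subset) auto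
      then have "p ` arc n s i \<subseteq> {..<n}"
        using p permutes_image[of p "{..<n}"] by blast
      moreover have "card (p ` arc n s i) = s"
        using p r by (simp add: card_image permutes_inj_on card_arc)
      ultimately show "p ` arc n s i \<in> W'" using up[OF t(3)] by blast
    qed
    then have "card {i. i < n \<and> (\<exists>t\<le>s - r. (i + t) mod n \<in> ?D)} \<le> ?M p"
      by (intro card_mono) auto
    moreover have "min n (card ?D + (s - r)) \<le> card {i. i < n \<and> (\<exists>t\<le>s - r. (i + t) mod n \<in> ?D)}"
      by (rule card_cyclic_thickening_ge) (use False in auto)
    ultimately have M: "min n (card ?D + (s - r)) \<le> ?M p" by linarith
    \<comment> \<open>If the minimum is \<open>n\<close>, this is \<open>s \<le> n\<close> times
      \<open>card ?D \<le> r\<close>. Otherwise, with \<open>s = r + k\<close>, it reduces to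
      \<open>k * card ?D \<le> k * r\<close>.\<close>
    have "s * ?m p \<le> r * min n (card ?D + (s - r))"
    proof (cases "n \<le> card ?D + (s - r)")
      case True
      have "s * ?m p \<le> n * r" using mr r by (intro mult_le_mono) auto
      then show ?thesis using True by (simp add: mult.commute)
    next
      case F: False
      obtain k where k: "s = r + k" using r le_Suc_ex by blast
      have "k * ?m p \<le> k * r" using mr by simp
      then have "s * ?m p \<le> r * (card ?D + (s - r))" unfolding k by (simp add: algebra_simps)
      then show ?thesis using F by simp
    qed
    also have "\<dots> \<le> r * ?M p" using M by simp
    finally show ?thesis .
  next
    case True
    then show ?thesis by (simp only: card.empty)
  qed
  have 1: "(\<Sum>p\<in>?P. ?m p) * ((n - 1) choose (r - 1)) = card W * fact n * r"
    using sum_card_arcs[OF W] r by simp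
  have 2: "(\<Sum>p\<in>?P. ?M p) * ((n - 1) choose (s - 1)) = card W' * fact n * s"
    using sum_card_arcs[OF W'] r by simp
  have 3: "s * (\<Sum>p\<in>?P. ?m p) \<le> r * (\<Sum>p\<in>?P. ?M p)"
    unfolding sum_distrib_left by (rule sum_mono) (rule each)
  have "(fact n * r * s) * (card W * ((n - 1) choose (s - 1)))
      = s * (\<Sum>p\<in>?P. ?m p) * (((n - 1) choose (r - 1)) * ((n - 1) choose (s - 1)))"
    using 1 by (simp add: algebra_simps)
  also have "\<dots> \<le> r * (\<Sum>p\<in>?P. ?M p) * (((n - 1) choose (r - 1)) * ((n - 1) choose (s - 1)))"
    using 3 by (intro mult_right_mono) auto
  also have "\<dots> = (fact n * r * s) * (card W' * ((n - 1) choose (r - 1)))"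
    using 2 by (simp add: algebra_simps)
  finally show ?thesis using r by simp
qed

section \<open>Level sizes of an intersecting upset\<close>

definition level :: "'a set set \<Rightarrow> nat \<Rightarrow> nat" where
  "level U j = card {Y \<in> U. card Y = j}"

text \<open>As \<open>intersecting\<close> also compares a member with itself, the empty set is
  excluded.\<close>

definition intersecting_upset :: "nat \<Rightarrow> nat set set \<Rightarrow> bool" where
  "intersecting_upset n U \<longleftrightarrow> U \<subseteq> Pow {..<n} \<and> intersecting U \<and>
     (\<forall>Y Z. Y \<in> U \<longrightarrow> Y \<subseteq> Z \<longrightarrow> Z \<subseteq> {..<n} \<longrightarrow> Z \<in> U)"

lemma level_upshadow:
  assumes U: "intersecting_upset n U" and "0 < r" "2 * r \<le> n" "r \<le> s" "s \<le> n"
  shows "level U r * ((n - 1) choose (s - 1)) \<le> level U s * ((n - 1) choose (r - 1))"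
  unfolding level_def
proof (rule intersecting_upshadow)
  show "intersecting {Y \<in> U. card Y = r}"
    using U by (auto simp: intersecting_upset_def intersecting_def)
qed (use assms in \<open>auto simp: intersecting_upset_def\<close>)

text \<open>The Erdos-Ko-Rado bound, read off from the ratio comparison with level \<open>n\<close>,
  whose only possible member is \<open>{..<n}\<close>.\<close>

lemma level_le_binomial:
  assumes U: "intersecting_upset n U" and "0 < j" "2 * j \<le> n"
  shows "level U j \<le> (n - 1) choose (j - 1)"
proof -
  have "{Y \<in> U. card Y = n} \<subseteq> {{..<n}}"
    using U card_subset_eq[of "{..<n}"] by (auto simp: intersecting_upset_def)
  then have "level U n \<le> 1"
    unfolding level_def using card_mono[of "{{..<n}}"] by fastforce
  then have "level U n * ((n - 1) choose (j - 1)) \<le> 1 * ((n - 1) choose (j - 1))"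
    by (rule mult_le_mono1)
  moreover have "level U j * 1 \<le> level U n * ((n - 1) choose (j - 1))"
    using level_upshadow[OF assms, of n] assms(2,3) by simp
  ultimately show ?thesis by linarith
qed

text \<open>The star of an element has equally many members on levels \<open>r\<close> and
  \<open>n - r + 1\<close>, so the ratio comparison between them becomes a plain inequality.\<close>

lemma level_le_level_upper:
  assumes U: "intersecting_upset n U" and "0 < r" "2 * r \<le> n"
  shows "level U r \<le> level U (n - r + 1)"
proof -
  have "(n - 1) choose (n - r) = (n - 1) choose (r - 1)"
    using binomial_symmetric[of "r - 1" "n - 1"] assms by simp
  moreover have "0 < (n - 1) choose (r - 1)" using assms by simp
  ultimately show ?thesis using level_upshadow[OF assms, of "n - r + 1"] assms(2,3) by simp
qed

text \<open>The complement of a member is never a member, so the \<open>j\<close>-sets in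
  \<open>U\<close> and the complements of the \<open>(n - j)\<close>-sets in \<open>U\<close> are
  distinct \<open>j\<close>-sets.\<close>

lemma level_add_level_compl_le:
  assumes U: "intersecting_upset n U" and "j \<le> n"
  shows "level U j + level U (n - j) \<le> n choose j"
proof -
  let ?A = "{Y \<in> U. card Y = j}" and ?B = "{Y \<in> U. card Y = n - j}"
  have sub: "Y \<subseteq> {..<n}" if "Y \<in> U" for Y using U that by (auto simp: intersecting_upset_def)
  have fin: "finite U" using U finite_subset[of U "Pow {..<n}"] by (auto simp: intersecting_upset_def)
  have inj: "inj_on ((-) {..<n}) ?B" using sub by (intro inj_onI) (metis (mono_tags) double_diff mem_Collect_eq order_refl)
  have "level U j + level U (n - j) = card ?A + card ((-) {..<n} ` ?B)"
    by (simp add: level_def card_image[OF inj])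
  also have "\<dots> = card (?A \<union> (-) {..<n} ` ?B)"
  proof (rule card_Un_disjoint[symmetric])
    show "?A \<inter> (-) {..<n} ` ?B = {}"
    proof (rule ccontr)
      assume "\<not> ?thesis"
      then obtain Y where "Y \<in> U" "{..<n} - Y \<in> U" by auto
      then have "({..<n} - Y) \<inter> Y \<noteq> {}"
        using U unfolding intersecting_upset_def intersecting_def by blast
      then show False by blast
    qed
  qed (use fin in auto)
  also have "\<dots> \<le> card {Y. Y \<subseteq> {..<n} \<and> card Y = j}"
  proof (rule card_mono)
    show "?A \<union> (-) {..<n} ` ?B \<subseteq> {Y. Y \<subseteq> {..<n} \<and> card Y = j}"
    proof -
      have "card ({..<n} - Y) = j" if "Y \<in> ?B" for Y
        using that sub[of Y] \<open>j \<le> n\<close> by (simp add: card_Diff_subset finite_subset[of Y "{..<n}"])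
      then show ?thesis using sub by blast
    qed
  qed simp
  also have "\<dots> = n choose j" by (simp add: n_subsets)
  finally show ?thesis .
qed

text \<open>The levels \<open>j\<close> and \<open>n - j\<close> are treated together: only their sum is controlled when
  \<open>n - j\<close> is above the middle.\<close>

lemma sum_mult_ge_paired:
  fixes v e :: "nat \<Rightarrow> int"
  assumes n: "2 \<le> n"
    and e: "\<And>j. 0 < j \<Longrightarrow> 2 * j \<le> n \<Longrightarrow> 0 \<le> e j"
    and ee: "\<And>j. 0 < j \<Longrightarrow> j < n \<Longrightarrow> 0 \<le> e j + e (n - j)"
    and v: "\<And>j. 0 < j \<Longrightarrow> j < n \<Longrightarrow> 0 \<le> v j"
    and vv: "\<And>j. 0 < j \<Longrightarrow> 2 * j < n \<Longrightarrow> v (n - j) \<le> v j"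
  shows "(v 1 - v (n - 1)) * e 1 \<le> 2 * (\<Sum>j\<in>{1..<n}. v j * e j)"
proof -
  let ?T = "\<lambda>j. v j * e j + v (n - j) * e (n - j)"
  \<comment> \<open>The pair \<open>?T j\<close> is \<open>(v j - v (n - j)) * e j\<close> plus the
    nonnegative \<open>v (n - j) * (e j + e (n - j))\<close>.\<close>
  have T: "(v j - v (n - j)) * e j \<le> ?T j" if "0 < j" "j < n" for j
  proof -
    have "0 \<le> v (n - j) * (e j + e (n - j))" using that ee v by (intro mult_nonneg_nonneg) auto
    then show ?thesis by (simp add: algebra_simps)
  qed
  have small: "0 \<le> ?T j" if "0 < j" "2 * j \<le> n" for j
  proof (cases "2 * j = n")
    case True
    then have "n - j = j" by simp
    then show ?thesis using T[of j] that by simp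
  next
    case False
    then have "0 \<le> (v j - v (n - j)) * e j" using that e vv by (intro mult_nonneg_nonneg) auto
    then show ?thesis using T[of j] that False by linarith
  qed
  have T0: "0 \<le> ?T j" if "j \<in> {1..<n}" for j
  proof (cases "2 * j \<le> n")
    case False
    then show ?thesis using small[of "n - j"] that by (auto simp: add.commute)
  qed (use small that in auto)
  \<comment> \<open>Summing \<open>?T\<close> over all \<open>j\<close> meets every pair twice,
    whence the factor \<open>2\<close>.\<close>
  have "(\<Sum>j\<in>{1..<n}. v j * e j) = (\<Sum>j\<in>{1..<n}. v (n - j) * e (n - j))"
    by (rule sum.reindex_bij_witness[of _ "\<lambda>j. n - j" "\<lambda>j. n - j"]) auto
  then have "2 * (\<Sum>j\<in>{1..<n}. v j * e j) = (\<Sum>j\<in>{1..<n}. ?T j)"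
    by (simp add: sum.distrib)
  moreover have "?T 1 \<le> (\<Sum>j\<in>{1..<n}. ?T j)"
    using T0 n by (intro member_le_sum) auto
  ultimately show ?thesis using T[of 1] n by simp
qed

text \<open>With \<open>d = n - r\<close> the upper index is at least \<open>d + 2\<close>, and
  \<open>(d + 2) choose 2\<close> is at least \<open>d + 2\<close>. This keeps the weights of a pair
  in order after level \<open>n - r + 1\<close> has lost \<open>1\<close>.\<close>

lemma binomial_pair_gap:
  fixes r n :: nat
  assumes "r < n" "n - r + 1 < r - 1"
  shows "((r - 1) choose (n - r)) \<ge> n - r + 2"
proof -
  define d where "d = n - r"
  have d: "1 \<le> d" using assms by (simp add: d_def)
  have "((d + 2) choose d) \<le> ((r - 1) choose d)"
    using assms by (intro binomial_right_mono) (simp add: d_def)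
  moreover have "(d + 2) choose d = (d + 2) choose 2"
    using binomial_symmetric[of d "d + 2"] by simp
  moreover have "d + 2 \<le> (d + 2) choose 2"
  proof -
    obtain k where "d = Suc k" using d by (cases d) auto
    then show ?thesis by (simp add: numeral_2_eq_2)
  qed
  ultimately show ?thesis by (simp add: d_def)
qed

text \<open>\<open>(n - j) choose (n - r)\<close> counts the ways to complete \<open>j\<close> leaves by \<open>r - j\<close> middle vertices with
  other indices; it is \<open>0\<close> for \<open>j > r\<close>. The subtracted term counts the rooted sets that are excluded.\<close>

definition claw_val :: "nat \<Rightarrow> nat \<Rightarrow> (nat \<Rightarrow> nat) \<Rightarrow> int" where
  "claw_val n r u = (\<Sum>j\<in>{1..<n}. int ((n - j) choose (n - r)) * int (u j)) - int (u (n - r + 1))"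

text \<open>The gap to the star is a weighted sum of the deficits \<open>e j\<close>, less the
  deficit at \<open>n - r + 1\<close>. For \<open>2 * r \<le> n\<close> the term at \<open>r\<close>
  pays for the latter; otherwise it is absorbed into the weights and levels \<open>j\<close> and
  \<open>n - j\<close> are paired. In both cases, when \<open>r \<ge> 2\<close>, the gap dominates
  \<open>e 1 / 2\<close>, so equality gives \<open>e 1 \<le> 0\<close>, that is, a singleton in
  \<open>U\<close>.\<close>

lemma claw_val_level_le:
  assumes U: "intersecting_upset n U" and r: "1 \<le> r" "r < n"
  defines "c \<equiv> \<lambda>j. (n - 1) choose (j - 1)"
  shows "claw_val n r (level U) \<le> claw_val n r c"
    and "2 \<le> r \<Longrightarrow> claw_val n r (level U) = claw_val n r c \<Longrightarrow> 1 \<le> level U 1"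
proof -
  define e where "e j = int (c j) - int (level U j)" for j
  define w where "w j = int ((n - j) choose (n - r))" for j
  have diff: "claw_val n r c - claw_val n r (level U)
      = (\<Sum>j\<in>{1..<n}. w j * e j) - e (n - r + 1)"
    by (simp add: claw_val_def e_def w_def sum_subtractf algebra_simps)
  have e0: "0 \<le> e j" if "0 < j" "2 * j \<le> n" for j
    using level_le_binomial[OF U that] by (simp add: e_def c_def)
  have key: "0 \<le> (\<Sum>j\<in>{1..<n}. w j * e j) - e (n - r + 1) \<and>
      (2 \<le> r \<longrightarrow> e 1 \<le> 2 * ((\<Sum>j\<in>{1..<n}. w j * e j) - e (n - r + 1)))"
  proof (cases "2 * r \<le> n")
    case True
    have "e (n - r + 1) \<le> e r"
    proof -
      have "c (n - r + 1) = c r" using binomial_symmetric[of "r - 1" "n - 1"] r by (simp add: c_def)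
      then show ?thesis using level_le_level_upper[OF U _ True] r by (simp add: e_def)
    qed
    \<comment> \<open>The weight vanishes above \<open>r\<close> and is \<open>1\<close> at
      \<open>r\<close>.\<close>
    moreover have "(\<Sum>j\<in>{1..<n}. w j * e j) = (\<Sum>j\<in>{1..r}. w j * e j)"
      using r by (intro sum.mono_neutral_right) (auto simp: w_def)
    moreover have "(\<Sum>j\<in>{1..r}. w j * e j) = (\<Sum>j\<in>{1..<r}. w j * e j) + e r"
    proof -
      have "{1..r} = insert r {1..<r}" using r by auto
      then show ?thesis by (simp add: w_def)
    qed
    moreover have pos: "0 \<le> w j * e j" if "j \<in> {1..<r}" for j
      using that True by (intro mult_nonneg_nonneg e0) (auto simp: w_def)
    moreover have "0 \<le> (\<Sum>j\<in>{1..<r}. w j * e j)" by (rule sum_nonneg) (rule pos)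
    moreover have "e 1 \<le> (\<Sum>j\<in>{1..<r}. w j * e j)" if "2 \<le> r"
    proof -
      have "w 1 * e 1 \<le> (\<Sum>j\<in>{1..<r}. w j * e j)"
        using pos that by (intro member_le_sum) auto
      moreover have "1 * e 1 \<le> w 1 * e 1"
        using r e0[of 1] by (intro mult_right_mono) (auto simp: w_def Suc_le_eq)
      ultimately show ?thesis by simp
    qed
    ultimately show ?thesis by auto
  next
    case False
    \<comment> \<open>The subtracted deficit becomes a weight lowered by \<open>1\<close> at
      \<open>n - r + 1\<close>. It stays nonnegative, since \<open>2 * r > n\<close> gives
      \<open>n - r \<le> r - 1\<close>.\<close>
    define v where "v j = w j - (if j = n - r + 1 then 1 else 0)" for j
    have w_anti: "w j \<le> w i" if "i \<le> j" for i j
      using that by (simp add: w_def binomial_right_mono diff_le_mono2)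
    have pairing: "(v 1 - v (n - 1)) * e 1 \<le> 2 * (\<Sum>j\<in>{1..<n}. v j * e j)"
    proof (rule sum_mult_ge_paired)
      show "0 \<le> e j + e (n - j)" if j: "0 < j" "j < n" for j
      proof -
        have "c j + c (n - j) = n choose j"
        proof -
          obtain m where m: "n = Suc m" using r by (cases n) auto
          obtain i where i: "j = Suc i" using j by (cases j) auto
          have "m choose (m - j) = m choose j" using j m by (simp flip: binomial_symmetric)
          then show ?thesis by (simp add: c_def m i)
        qed
        then show ?thesis using level_add_level_compl_le[OF U, of j] j by (simp add: e_def)
      qed
      show "0 \<le> v j" for j
        using False r by (auto simp: v_def w_def Suc_le_eq)
      show "v (n - j) \<le> v j" if j: "0 < j" "2 * j < n" for j
      \<comment> \<open>Only this \<open>j\<close> needs care: lowering the weight of the smaller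
        level of a pair could reverse the order, while lowering that of the larger level
        helps.\<close>
      proof (cases "j = n - r + 1")
        case True
        have "n - r + 2 \<le> (r - 1) choose (n - r)"
          using binomial_pair_gap[of r n] j r True by linarith
        moreover have "n - (n - j) = Suc (n - r)" using True j by simp
        then have "w (n - j) = int (Suc (n - r))" by (simp only: w_def binomial_Suc_n)
        moreover have "w j = int ((r - 1) choose (n - r))" using True r by (simp add: w_def)
        ultimately show ?thesis using True by (simp add: v_def)
      next
        case False
        then have "v j = w j" by (simp add: v_def)
        moreover have "w (n - j) \<le> w j" using w_anti[of j "n - j"] j by simp
        moreover have "v (n - j) \<le> w (n - j)" by (simp add: v_def)
        ultimately show ?thesis by linarith
      qed
    qed (use e0 r in auto)
    have sum_eq: "(\<Sum>j\<in>{1..<n}. v j * e j) = (\<Sum>j\<in>{1..<n}. w j * e j) - e (n - r + 1)"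
    proof -
      have "v j * e j = w j * e j - (if j = n - r + 1 then e (n - r + 1) else 0)" for j
        by (simp add: v_def algebra_simps)
      moreover have "Suc (n - r) < n" using r False by linarith
      ultimately show ?thesis by (simp add: sum_subtractf)
    qed
    \<comment> \<open>Here \<open>v 1 = w 1 \<ge> 2\<close> and
      \<open>v (n - 1) \<le> w (n - 1) \<le> 1\<close>.\<close>
    have "e 1 \<le> (v 1 - v (n - 1)) * e 1"
    proof -
      have "2 \<le> r" using False r by auto
      have "2 \<le> (n - 1) choose (n - r)"
      proof -
        obtain m where m: "n - 1 = Suc m" using r by (cases "n - 1") auto
        obtain k where k: "n - r = Suc k" using r by (cases "n - r") auto
        from m k have "0 < m choose k" "0 < m choose Suc k" using \<open>2 \<le> r\<close> by auto
        moreover have "(n - 1) choose (n - r) = (m choose k) + (m choose Suc k)" by (simp only: m k binomial_Suc_Suc)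
        ultimately show ?thesis by linarith
      qed
      then have "2 \<le> w 1" using r \<open>2 \<le> r\<close> by (simp add: w_def)
      moreover have "1 choose (n - r) \<le> (1::nat)"
        using r binomial_right_mono[of 0 1] by (cases "n - r = 1") (auto simp: binomial_eq_0)
      then have "w (n - 1) \<le> 1" using r by (simp add: w_def)
      ultimately have "1 \<le> v 1 - v (n - 1)" using r by (auto simp: v_def)
      then have "1 * e 1 \<le> (v 1 - v (n - 1)) * e 1" using e0[of 1] r by (intro mult_right_mono) auto
      then show ?thesis by simp
    qed
    then have "e 1 \<le> 2 * (\<Sum>j\<in>{1..<n}. v j * e j)" using pairing by (rule order_trans)
    moreover have "0 \<le> e 1" using e0[of 1] r by simp
    ultimately show ?thesis unfolding sum_eq by auto
  qed
  show "claw_val n r (level U) \<le> claw_val n r c" using key diff by linarith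
  assume "2 \<le> r" "claw_val n r (level U) = claw_val n r c"
  then have "e 1 \<le> 0" using key diff by auto
  then show "1 \<le> level U 1" by (simp add: e_def c_def)
qed

section \<open>Independent sets of the claw\<close>

abbreviation claw_sets :: "nat \<Rightarrow> nat \<Rightarrow> claw_vertex set set" where
  "claw_sets n r \<equiv> r_independent_sets (claw_V n) (claw_E n) r"

lemma finite_claw_V: "finite (claw_V n)"
  by (simp add: claw_V_def)

text \<open>Every edge has a middle vertex as an endpoint, so independence only restricts what
  accompanies a middle vertex.\<close>

lemma claw_sets_iff:
  "S \<in> claw_sets n r \<longleftrightarrow>
     S \<subseteq> claw_V n \<and> card S = r \<and> (\<forall>i. Mid i \<in> S \<longrightarrow> Root \<notin> S \<and> Leaf i \<notin> S)"
proof (cases "S \<subseteq> claw_V n")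
  case True
  then have "finite S" by (rule finite_subset) (rule finite_claw_V)
  moreover have "i < n" if "Mid i \<in> S" for i using that True by (auto simp: claw_V_def)
  ultimately show ?thesis using True
    unfolding r_independent_sets_def independent_set_def claw_E_def doubleton_eq_iff by blast
qed (simp add: r_independent_sets_def independent_set_def)

lemma finite_claw_sets: "finite (claw_sets n r)"
  by (rule finite_subset[of _ "Pow (claw_V n)"]) (auto simp: claw_sets_iff finite_claw_V)

lemma finite_in_claw_sets: "S \<in> claw_sets n r \<Longrightarrow> finite S"
  by (simp add: r_independent_sets_def)

lemma card_exchange: "finite S \<Longrightarrow> a \<in> S \<Longrightarrow> b \<notin> S \<Longrightarrow> card (insert b (S - {a})) = card S"
  by (metis DiffD1 card_Suc_Diff1 card_insert_disjoint finite_Diff)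

lemma claw_set_MidD:
  assumes "S \<in> claw_sets n r" "Mid i \<in> S"
  shows "Leaf i \<notin> S" "Root \<notin> S" "i < n"
proof -
  have "Mid i \<in> claw_V n" using assms by (auto simp: claw_sets_iff)
  then show "i < n" by (auto simp: claw_V_def)
qed (use assms in \<open>auto simp: claw_sets_iff\<close>)

definition leaves :: "claw_vertex set \<Rightarrow> nat set" where
  "leaves S = {i. Leaf i \<in> S}"

definition mids :: "claw_vertex set \<Rightarrow> nat set" where
  "mids S = {i. Mid i \<in> S}"

text \<open>A rootless independent set is a partial sign vector: an index is used by its leaf (in
  \<open>P\<close>), by its middle vertex (in \<open>M\<close>) or not at all.\<close>

definition signed :: "nat set \<Rightarrow> nat set \<Rightarrow> claw_vertex set" where
  "signed P M = Leaf ` P \<union> Mid ` M"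

definition rooted :: "nat set \<Rightarrow> claw_vertex set" where
  "rooted L = insert Root (Leaf ` L)"

lemma leaves_mids_simps [simp]:
  "leaves (signed P M) = P" "mids (signed P M) = M" "leaves (rooted L) = L" "mids (rooted L) = {}"
  "Root \<notin> signed P M" "Root \<in> rooted L"
  by (auto simp: leaves_def mids_def signed_def rooted_def)

lemma mem_signed_rooted [simp]:
  "Leaf i \<in> signed P M \<longleftrightarrow> i \<in> P" "Mid i \<in> signed P M \<longleftrightarrow> i \<in> M"
  "Leaf i \<in> rooted L \<longleftrightarrow> i \<in> L" "Mid i \<notin> rooted L"
  by (auto simp: signed_def rooted_def)

lemma subset_claw_V [simp]:
  "signed P M \<subseteq> claw_V n \<longleftrightarrow> P \<subseteq> {..<n} \<and> M \<subseteq> {..<n}"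
  "rooted L \<subseteq> claw_V n \<longleftrightarrow> L \<subseteq> {..<n}"
  by (auto simp: claw_V_def signed_def rooted_def)

lemma signed_leaves_mids: "Root \<notin> S \<Longrightarrow> signed (leaves S) (mids S) = S"
  unfolding signed_def leaves_def mids_def
  by (auto simp: image_iff) (metis claw_vertex.exhaust)

lemma rooted_leaves: "S \<in> claw_sets n r \<Longrightarrow> Root \<in> S \<Longrightarrow> rooted (leaves S) = S"
  unfolding rooted_def leaves_def claw_sets_iff
  by (auto simp: image_iff) (metis claw_vertex.exhaust)

lemma card_signed:
  assumes "finite P" "finite M"
  shows "card (signed P M) = card P + card M"
proof -
  have "card (signed P M) = card (Leaf ` P) + card (Mid ` M)"
    unfolding signed_def using assms by (intro card_Un_disjoint) auto
  then show ?thesis by (simp add: card_image inj_on_def)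
qed

lemma card_rooted: "finite L \<Longrightarrow> card (rooted L) = Suc (card L)"
  by (simp add: rooted_def card_insert_if image_iff card_image inj_on_def)

lemma signed_in_claw_sets_iff:
  "signed P M \<in> claw_sets n r \<longleftrightarrow> P \<subseteq> {..<n} \<and> M \<subseteq> {..<n} - P \<and> card P + card M = r"
proof (cases "P \<subseteq> {..<n} \<and> M \<subseteq> {..<n}")
  case True
  then have "finite P" "finite M" by (auto intro: finite_subset)
  then show ?thesis using True card_signed[of P M]
    by (auto simp: claw_sets_iff)
qed (auto simp: claw_sets_iff)

lemma rooted_in_claw_sets_iff:
  assumes "1 \<le> r"
  shows "rooted L \<in> claw_sets n r \<longleftrightarrow> L \<subseteq> {..<n} \<and> card L = r - 1"
proof (cases "L \<subseteq> {..<n}")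
  case True
  then have "finite L" by (auto intro: finite_subset)
  then show ?thesis using True card_rooted[of L] assms
    by (auto simp: claw_sets_iff)
qed (auto simp: claw_sets_iff)

section \<open>The family generated by an upset and its size\<close>

definition signed_index :: "nat \<Rightarrow> nat \<Rightarrow> nat set set \<Rightarrow> (nat set \<times> nat set) set" where
  "signed_index n r U = (SIGMA P:U. {M. M \<subseteq> {..<n} - P \<and> card P + card M = r})"

text \<open>When \<open>U\<close> is an upset, a leaf set \<open>L\<close> meets all members of \<open>U\<close> iff its complement is not in \<open>U\<close>.\<close>

definition upset_family :: "nat \<Rightarrow> nat \<Rightarrow> nat set set \<Rightarrow> claw_vertex set set" where
  "upset_family n r U = (\<lambda>(P, M). signed P M) ` signed_index n r U \<union>
     rooted ` {L. L \<subseteq> {..<n} \<and> card L = r - 1 \<and> {..<n} - L \<notin> U}"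

text \<open>A \<open>P\<close> of size \<open>j\<close> is completed in
  \<open>(n - j) choose (r - j)\<close> ways. The symmetric form with \<open>n - r\<close> is also
  right for \<open>j > r\<close>, where truncated subtraction would give \<open>1\<close> instead of
  \<open>0\<close>. Levels \<open>0\<close> and \<open>n\<close> drop out because \<open>{}\<close>
  is not in \<open>U\<close> and \<open>r < n\<close>.\<close>

lemma card_signed_index:
  assumes U: "U \<subseteq> Pow {..<n}" "{} \<notin> U" and r: "1 \<le> r" "r < n"
  shows "card (signed_index n r U) = (\<Sum>j\<in>{1..<n}. ((n - j) choose (n - r)) * level U j)"
proof -
  have finU: "finite U" using U finite_subset by blast
  have slice: "card {M. M \<subseteq> {..<n} - P \<and> card P + card M = r} = (n - card P) choose (n - r)"
    if "P \<in> U" for P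
  proof -
    have P: "P \<subseteq> {..<n}" using that U by auto
    then have cP: "card ({..<n} - P) = n - card P" "card P \<le> n"
      using finite_subset[of P "{..<n}"] card_mono[of "{..<n}" P] by (auto simp: card_Diff_subset)
    show ?thesis
    proof (cases "card P \<le> r")
      case True
      then have "{M. M \<subseteq> {..<n} - P \<and> card P + card M = r} = {M. M \<subseteq> {..<n} - P \<and> card M = r - card P}"
        by auto
      then have "card {M. M \<subseteq> {..<n} - P \<and> card P + card M = r} = (n - card P) choose (r - card P)"
        using n_subsets[of "{..<n} - P"] cP by simp
      also have "\<dots> = (n - card P) choose (n - r)"
        using binomial_symmetric[of "r - card P" "n - card P"] True r by simp
      finally show ?thesis .
    next
      case False
      then have "{M. M \<subseteq> {..<n} - P \<and> card P + card M = r} = {}" by auto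
      moreover have "n - card P < n - r" using False cP by simp
      ultimately show ?thesis by (simp only: card.empty binomial_eq_0)
    qed
  qed
  have "card (signed_index n r U) = (\<Sum>P\<in>U. (n - card P) choose (n - r))"
    unfolding signed_index_def using finU slice by (subst card_SigmaI) auto
  also have "\<dots> = (\<Sum>j\<in>{..n}. \<Sum>P\<in>{P \<in> U. card P = j}. (n - card P) choose (n - r))"
  proof (rule sum.group[symmetric])
    have "card P \<le> n" if "P \<in> U" for P using that U card_mono[of "{..<n}" P] by auto
    then show "card ` U \<subseteq> {..n}" by auto
  qed (use finU in auto)
  also have "\<dots> = (\<Sum>j\<in>{..n}. ((n - j) choose (n - r)) * level U j)"
    by (intro sum.cong refl) (simp add: level_def)
  also have "\<dots> = (\<Sum>j\<in>{1..<n}. ((n - j) choose (n - r)) * level U j)"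
  proof (rule sum.mono_neutral_right)
    have "card Y \<noteq> 0" if "Y \<in> U" for Y
      using that U finite_subset[of Y "{..<n}"] by (auto simp: card_eq_0_iff)
    then have no_empty: "{Y \<in> U. card Y = 0} = {}" by blast
    have "level U 0 = 0" unfolding level_def no_empty by simp
    moreover have "j = 0 \<or> j = n" if "j \<in> {..n} - {1..<n}" for j using that by auto
    ultimately show "\<forall>j\<in>{..n} - {1..<n}. ((n - j) choose (n - r)) * level U j = 0"
      using r by fastforce
  qed auto
  finally show ?thesis .
qed

text \<open>The root separates the two kinds of members. The leaf sets missing from the rooted kind
  correspond by complementation to the members of \<open>U\<close> of size
  \<open>n - r + 1\<close>.\<close>

lemma card_upset_family:
  assumes U: "U \<subseteq> Pow {..<n}" "{} \<notin> U" and r: "1 \<le> r" "r < n"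
  shows "int (card (upset_family n r U)) = claw_val n r (level U) + int (n choose (r - 1))"
proof -
  let ?R = "{L. L \<subseteq> {..<n} \<and> card L = r - 1}"
  let ?R1 = "{L \<in> ?R. {..<n} - L \<notin> U}" and ?R2 = "{L \<in> ?R. {..<n} - L \<in> U}"
  have finU: "finite U" using U finite_subset by blast
  have finS: "finite (signed_index n r U)"
    unfolding signed_index_def using finU by (intro finite_SigmaI) auto
  have "card (upset_family n r U) = card ((\<lambda>(P, M). signed P M) ` signed_index n r U) + card (rooted ` ?R1)"
    unfolding upset_family_def
  proof (subst card_Un_disjoint)
    show "(\<lambda>(P, M). signed P M) ` signed_index n r U \<inter>
        rooted ` {L. L \<subseteq> {..<n} \<and> card L = r - 1 \<and> {..<n} - L \<notin> U} = {}"
      using leaves_mids_simps(5,6) by (auto simp: image_iff) (metis leaves_mids_simps(5,6))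
  qed (use finS in \<open>auto simp: conj_assoc\<close>)
  also have "card ((\<lambda>(P, M). signed P M) ` signed_index n r U) = card (signed_index n r U)"
    by (rule card_image) (auto intro!: inj_onI dest: arg_cong[of _ _ leaves] arg_cong[of _ _ mids])
  also have "card (rooted ` ?R1) = card ?R1"
    by (rule card_image) (auto intro!: inj_onI dest: arg_cong[of _ _ leaves])
  finally have 1: "card (upset_family n r U) = card (signed_index n r U) + card ?R1" .
  have "card ?R = card ?R1 + card ?R2"
  proof -
    have "card ?R = card (?R1 \<union> ?R2)" by (rule arg_cong[of _ _ card]) auto
    also have "\<dots> = card ?R1 + card ?R2" by (rule card_Un_disjoint) auto
    finally show ?thesis .
  qed
  moreover have "card ?R = n choose (r - 1)" by (simp add: n_subsets)
  moreover have "card ?R2 = level U (n - r + 1)"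
    unfolding level_def
  proof (rule bij_betw_same_card[of "(-) {..<n}"], rule bij_betw_byWitness[where f' = "(-) {..<n}"])
    have "card ({..<n} - L) = n - r + 1" if "L \<in> ?R2" for L
      using that r by (auto simp: card_Diff_subset finite_subset[of L "{..<n}"])
    then show "(-) {..<n} ` ?R2 \<subseteq> {Y \<in> U. card Y = n - r + 1}" by auto
    have "card ({..<n} - Y) = r - 1" "{..<n} - ({..<n} - Y) = Y" if "Y \<in> {Y \<in> U. card Y = n - r + 1}" for Y
    proof -
      have "Y \<subseteq> {..<n}" using that U by auto
      then show "card ({..<n} - Y) = r - 1" "{..<n} - ({..<n} - Y) = Y"
        using that r by (auto simp: card_Diff_subset finite_subset[of Y "{..<n}"])
    qed
    then show "(-) {..<n} ` {Y \<in> U. card Y = n - r + 1} \<subseteq> ?R2" by auto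
  qed (use U in auto)
  ultimately have "int (card ?R1) = int (n choose (r - 1)) - int (level U (n - r + 1))" by linarith
  then show ?thesis using 1 card_signed_index[OF U r] by (simp add: claw_val_def)
qed

section \<open>The star of a leaf\<close>

definition principal :: "nat \<Rightarrow> nat \<Rightarrow> nat set set" where
  "principal n x = {Y. Y \<subseteq> {..<n} \<and> x \<in> Y}"

lemma level_principal:
  assumes "x < n" "1 \<le> j"
  shows "level (principal n x) j = (n - 1) choose (j - 1)"
proof -
  have eq: "{Y \<in> principal n x. card Y = j} = insert x ` {Z. Z \<subseteq> {..<n} - {x} \<and> card Z = j - 1}"
  proof (intro equalityI subsetI)
    fix Y assume "Y \<in> {Y \<in> principal n x. card Y = j}"
    then have Y: "Y \<subseteq> {..<n}" "x \<in> Y" "card Y = j" by (auto simp: principal_def)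
    then have "Y - {x} \<in> {Z. Z \<subseteq> {..<n} - {x} \<and> card Z = j - 1}" by auto
    moreover have "Y = insert x (Y - {x})" using Y by auto
    ultimately show "Y \<in> insert x ` {Z. Z \<subseteq> {..<n} - {x} \<and> card Z = j - 1}" by blast
  next
    fix Y assume "Y \<in> insert x ` {Z. Z \<subseteq> {..<n} - {x} \<and> card Z = j - 1}"
    then obtain Z where Z: "Z \<subseteq> {..<n} - {x}" "card Z = j - 1" "Y = insert x Z" by auto
    moreover have "finite Z" using Z(1) finite_subset by blast
    ultimately show "Y \<in> {Y \<in> principal n x. card Y = j}"
      using assms by (auto simp: principal_def card_insert_if)
  qed
  have "inj_on (insert x) {Z. Z \<subseteq> {..<n} - {x} \<and> card Z = j - 1}"
    by (auto intro!: inj_onI)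
  then have "level (principal n x) j = card {Z. Z \<subseteq> {..<n} - {x} \<and> card Z = j - 1}"
    unfolding level_def eq by (rule card_image)
  then show ?thesis using assms by (simp add: n_subsets)
qed

text \<open>For rooted sets: \<open>x\<close> lies in \<open>L\<close> exactly when the complement
  of \<open>L\<close> is not in \<open>principal n x\<close>.\<close>

lemma star_Leaf_eq_upset_family:
  assumes "x < n" "1 \<le> r"
  shows "star_family (claw_V n) (claw_E n) r (Leaf x) = upset_family n r (principal n x)"
proof (intro equalityI subsetI)
  fix S assume "S \<in> star_family (claw_V n) (claw_E n) r (Leaf x)"
  then have S: "S \<in> claw_sets n r" "x \<in> leaves S" by (auto simp: star_family_def leaves_def)
  show "S \<in> upset_family n r (principal n x)"
  proof (cases "Root \<in> S")
    case True
    then have "rooted (leaves S) = S" using S rooted_leaves by blast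
    moreover from this have "leaves S \<subseteq> {..<n}" "card (leaves S) = r - 1"
      using S rooted_in_claw_sets_iff[OF assms(2)] by metis+
    ultimately show ?thesis using S(2) unfolding upset_family_def principal_def by blast
  next
    case False
    then have "signed (leaves S) (mids S) = S" by (rule signed_leaves_mids)
    moreover from this have "leaves S \<subseteq> {..<n}" "mids S \<subseteq> {..<n} - leaves S" "card (leaves S) + card (mids S) = r"
      using S signed_in_claw_sets_iff by metis+
    ultimately have "S = (\<lambda>(P, M). signed P M) (leaves S, mids S)"
      "(leaves S, mids S) \<in> signed_index n r (principal n x)"
      using S(2) by (auto simp: signed_index_def principal_def)
    then show ?thesis unfolding upset_family_def by blast
  qed
next
  fix S assume "S \<in> upset_family n r (principal n x)"
  then have "S \<in> claw_sets n r \<and> x \<in> leaves S"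
    using assms
    by (auto simp: upset_family_def signed_index_def principal_def signed_in_claw_sets_iff rooted_in_claw_sets_iff)
  then show "S \<in> star_family (claw_V n) (claw_E n) r (Leaf x)"
    by (simp add: star_family_def leaves_def)
qed

text \<open>Expressed through \<open>claw_val\<close>, so that it can be compared with other
  families without a closed form.\<close>

definition star_size :: "nat \<Rightarrow> nat \<Rightarrow> int" where
  "star_size n r = claw_val n r (\<lambda>j. (n - 1) choose (j - 1)) + int (n choose (r - 1))"

lemma card_star_Leaf:
  assumes "x < n" "1 \<le> r" "r < n"
  shows "int (card (star_family (claw_V n) (claw_E n) r (Leaf x))) = star_size n r"
proof -
  have "claw_val n r (level (principal n x)) = claw_val n r (\<lambda>j. (n - 1) choose (j - 1))"
    unfolding claw_val_def using level_principal[OF assms(1)] by simp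
  then show ?thesis
    using card_upset_family[of "principal n x" n r] assms star_Leaf_eq_upset_family[OF assms(1,2)]
    by (auto simp: principal_def star_size_def)
qed

section \<open>Compression\<close>

definition mid_to_leaf :: "nat \<Rightarrow> claw_vertex set \<Rightarrow> claw_vertex set" where
  "mid_to_leaf i S = (if Mid i \<in> S then insert (Leaf i) (S - {Mid i}) else S)"

text \<open>A member of \<open>F\<close> without \<open>Mid i\<close> is its own image under
  \<open>mid_to_leaf i\<close>, so the test keeps it as well.\<close>

definition shift_set :: "nat \<Rightarrow> claw_vertex set set \<Rightarrow> claw_vertex set \<Rightarrow> claw_vertex set" where
  "shift_set i F S = (if mid_to_leaf i S \<in> F then S else mid_to_leaf i S)"

definition shift :: "nat \<Rightarrow> claw_vertex set set \<Rightarrow> claw_vertex set set" where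
  "shift i F = shift_set i F ` F"

lemma mid_to_leaf_in_claw_sets:
  assumes S: "S \<in> claw_sets n r"
  shows "mid_to_leaf i S \<in> claw_sets n r"
proof (cases "Mid i \<in> S")
  case True
  then have "Leaf i \<notin> S" "i < n" "Root \<notin> S" using S claw_set_MidD by blast+
  moreover have "finite S" using S by (rule finite_in_claw_sets)
  ultimately have "card (insert (Leaf i) (S - {Mid i})) = card S"
    using True by (intro card_exchange)
  moreover have "Leaf i \<in> claw_V n" using \<open>i < n\<close> by (simp add: claw_V_def)
  ultimately show ?thesis using S True by (auto simp: claw_sets_iff mid_to_leaf_def)
qed (use S in \<open>simp add: mid_to_leaf_def\<close>)

lemma shift_set_moved:
  assumes "S \<in> F" "shift_set i F S \<noteq> S"
  shows "Mid i \<in> S" "shift_set i F S = insert (Leaf i) (S - {Mid i})" "shift_set i F S \<notin> F"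
  using assms by (auto simp: shift_set_def mid_to_leaf_def split: if_splits)

lemma shift_set_fixed:
  assumes "shift_set i F S = S" "S \<in> F"
  shows "mid_to_leaf i S \<in> F"
  using assms by (auto simp: shift_set_def split: if_splits)

text \<open>A moved set lands outside \<open>F\<close>, so it differs from every fixed one, and a
  moved set is recovered from its image by undoing the exchange.\<close>

lemma inj_on_shift_set:
  assumes F: "F \<subseteq> claw_sets n r"
  shows "inj_on (shift_set i F) F"
proof (rule inj_onI)
  fix S T assume ST: "S \<in> F" "T \<in> F" and eq: "shift_set i F S = shift_set i F T"
  consider "shift_set i F S = S" | "shift_set i F T = T" | "shift_set i F S \<noteq> S" "shift_set i F T \<noteq> T"
    by blast
  then show "S = T"
  proof cases
    case 3
    have "Leaf i \<notin> S" "Leaf i \<notin> T"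
      using F ST shift_set_moved(1)[OF ST(1) 3(1)] shift_set_moved(1)[OF ST(2) 3(2)] claw_set_MidD(1)
      by blast+
    then have "S = insert (Mid i) (shift_set i F S - {Leaf i})" "T = insert (Mid i) (shift_set i F T - {Leaf i})"
      using shift_set_moved(1,2)[OF ST(1) 3(1)] shift_set_moved(1,2)[OF ST(2) 3(2)] by blast+
    then show ?thesis using eq by simp
  qed (use ST eq shift_set_moved(3) in metis)+
qed

lemma shift_subset: "F \<subseteq> claw_sets n r \<Longrightarrow> shift i F \<subseteq> claw_sets n r"
  using mid_to_leaf_in_claw_sets by (auto simp: shift_def shift_set_def)

lemma card_shift: "F \<subseteq> claw_sets n r \<Longrightarrow> card (shift i F) = card F"
  unfolding shift_def by (intro card_image inj_on_shift_set)

text \<open>If the images were disjoint, \<open>S\<close> and \<open>T\<close> would share only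
  \<open>Mid i\<close>. But \<open>T\<close> stays because its compression is already in
  \<open>F\<close>, and that compression would then miss \<open>S\<close>.\<close>

lemma shift_moved_inter_fixed:
  assumes F: "F \<subseteq> claw_sets n r" "intersecting F" and ST: "S \<in> F" "T \<in> F"
    and S: "shift_set i F S \<noteq> S" and T: "shift_set i F T = T"
  shows "shift_set i F S \<inter> shift_set i F T \<noteq> {}"
proof
  assume empty: "shift_set i F S \<inter> shift_set i F T = {}"
  note m = shift_set_moved[OF ST(1) S]
  have LS: "Leaf i \<notin> S" using m(1) F ST by (auto simp: claw_sets_iff)
  have "S \<inter> T \<noteq> {}" using F ST by (auto simp: intersecting_def)
  then have "Mid i \<in> T" using empty m T by auto
  moreover have "S \<inter> mid_to_leaf i T \<noteq> {}"
    using shift_set_fixed[OF T ST(2)] F ST by (auto simp: intersecting_def)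
  ultimately show False using empty m T LS by (auto simp: mid_to_leaf_def)
qed

lemma intersecting_shift:
  assumes F: "F \<subseteq> claw_sets n r" "intersecting F"
  shows "intersecting (shift i F)"
proof -
  have "shift_set i F S \<inter> shift_set i F T \<noteq> {}" if ST: "S \<in> F" "T \<in> F" for S T
  proof (cases "shift_set i F S = S"; cases "shift_set i F T = T")
    assume "shift_set i F S = S" "shift_set i F T = T"
    then show ?thesis using F ST by (simp add: intersecting_def)
  next
    assume "shift_set i F S \<noteq> S" "shift_set i F T \<noteq> T"
    then show ?thesis using shift_set_moved(2) ST by blast
  next
    assume "shift_set i F S \<noteq> S" "shift_set i F T = T"
    then show ?thesis by (rule shift_moved_inter_fixed[OF F ST])
  next
    assume "shift_set i F S = S" "shift_set i F T \<noteq> T"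
    then show ?thesis using shift_moved_inter_fixed[OF F ST(2,1)] by (simp add: Int_commute)
  qed
  then show ?thesis by (auto simp: intersecting_def shift_def)
qed

text \<open>The termination measure for repeated compression: each moved set loses one middle
  vertex.\<close>

definition mid_count :: "claw_vertex set set \<Rightarrow> nat" where
  "mid_count F = (\<Sum>S\<in>F. card (mids S))"

lemma finite_mids: "S \<in> claw_sets n r \<Longrightarrow> finite (mids S)"
  by (rule finite_subset[of _ "{..<n}"]) (auto simp: mids_def dest: claw_set_MidD(3))

lemma mid_count_shift_less:
  assumes F: "F \<subseteq> claw_sets n r" and ne: "shift i F \<noteq> F"
  shows "mid_count (shift i F) < mid_count F"
proof -
  have finF: "finite F" using F finite_claw_sets finite_subset by blast
  have less: "card (mids (shift_set i F S)) < card (mids S)" if "S \<in> F" "shift_set i F S \<noteq> S" for S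
  proof -
    have "mids (shift_set i F S) = mids S - {i}" "i \<in> mids S"
      using shift_set_moved[OF that] by (auto simp: mids_def)
    moreover have "finite (mids S)" using F that finite_mids by blast
    ultimately show ?thesis by (metis card_Diff1_less)
  qed
  have "mid_count (shift i F) = (\<Sum>S\<in>F. card (mids (shift_set i F S)))"
    unfolding mid_count_def shift_def by (simp add: sum.reindex[OF inj_on_shift_set[OF F]])
  also have "\<dots> < mid_count F"
    unfolding mid_count_def
  proof (rule sum_strict_mono_ex1[OF finF])
    show "\<forall>S\<in>F. card (mids (shift_set i F S)) \<le> card (mids S)"
      using less by (metis less_imp_le order_refl)
    have "\<exists>S\<in>F. shift_set i F S \<noteq> S"
    proof (rule ccontr)
      assume "\<not> ?thesis"
      then have "shift i F = F" by (simp add: shift_def)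
      then show False using ne by simp
    qed
    then show "\<exists>S\<in>F. card (mids (shift_set i F S)) < card (mids S)" using less by blast
  qed
  finally show ?thesis .
qed

section \<open>Families fixed by all compressions\<close>

text \<open>Descent on the number of common middle vertices. If \<open>Mid i\<close> is common, the
  compression of \<open>S\<close> at \<open>i\<close> is also in \<open>F\<close> and shares fewer
  with \<open>T\<close>. A leaf common to it and \<open>T\<close> is not \<open>Leaf i\<close>, as
  \<open>T\<close> contains \<open>Mid i\<close>, so it already lies in \<open>S\<close>.\<close>

lemma shift_fixed_common_leaf:
  assumes F: "F \<subseteq> claw_sets n r" "intersecting F" and fixed: "\<And>i. shift i F = F"
    and "S \<in> F" "T \<in> F" "Root \<notin> S \<or> Root \<notin> T"
  shows "leaves S \<inter> leaves T \<noteq> {}"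
  using assms(4-)
proof (induction "card (mids S \<inter> mids T)" arbitrary: S rule: less_induct)
  case less
  obtain z where z: "z \<in> S" "z \<in> T" using F less.prems by (fastforce simp: intersecting_def)
  show ?case
  proof (cases z)
    case Root
    then show ?thesis using z less.prems by auto
  next
    case (Leaf i)
    then show ?thesis using z by (auto simp: leaves_def)
  next
    case (Mid i)
    have "shift_set i F S \<in> F" using fixed[of i] less.prems(1) by (auto simp: shift_def)
    then have dF: "mid_to_leaf i S \<in> F" by (auto simp: shift_set_def split: if_splits)
    have d: "mid_to_leaf i S = insert (Leaf i) (S - {Mid i})" using z Mid by (simp add: mid_to_leaf_def)
    have "mids (mid_to_leaf i S) \<inter> mids T = (mids S \<inter> mids T) - {i}" by (auto simp: d mids_def)
    moreover have "i \<in> mids S \<inter> mids T" using z Mid by (simp add: mids_def)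
    moreover have "finite (mids S \<inter> mids T)" using F less.prems finite_mids by blast
    ultimately have "card (mids (mid_to_leaf i S) \<inter> mids T) < card (mids S \<inter> mids T)"
      by (metis card_Diff1_less)
    moreover have "Root \<notin> mid_to_leaf i S \<or> Root \<notin> T" using less.prems(3) by (auto simp: d)
    ultimately have "leaves (mid_to_leaf i S) \<inter> leaves T \<noteq> {}"
      using less.hyps[OF _ dF less.prems(2)] by blast
    then obtain j where j: "Leaf j \<in> mid_to_leaf i S" "Leaf j \<in> T" by (auto simp: leaves_def)
    have "T \<in> claw_sets n r" using F(1) less.prems(2) by (rule subsetD)
    moreover have "Mid i \<in> T" using z(2) Mid by simp
    ultimately have "Leaf i \<notin> T" by (rule claw_set_MidD(1))
    then have "Leaf j \<in> S" using j unfolding d by auto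
    then show ?thesis using j(2) by (auto simp: leaves_def)
  qed
qed

definition leaf_upset :: "nat \<Rightarrow> claw_vertex set set \<Rightarrow> nat set set" where
  "leaf_upset n F = {Y. Y \<subseteq> {..<n} \<and> (\<exists>S\<in>F. Root \<notin> S \<and> leaves S \<subseteq> Y)}"

text \<open>The family embeds into \<open>upset_family n r U\<close>: a rooted member shares a leaf
  with every rootless one, so the complement of its leaf set contains no rootless leaf set.\<close>

lemma shift_fixed_bound:
  assumes F: "F \<subseteq> claw_sets n r" "intersecting F" and fixed: "\<And>i. shift i F = F"
    and r: "1 \<le> r" "r < n"
  shows "int (card F) \<le> star_size n r"
    and "2 \<le> r \<Longrightarrow> int (card F) = star_size n r \<Longrightarrow>
      \<exists>x<n. F = star_family (claw_V n) (claw_E n) r (Leaf x)"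
proof -
  define U where "U = leaf_upset n F"
  note common = shift_fixed_common_leaf[OF F fixed]
  have U: "intersecting_upset n U"
    unfolding intersecting_upset_def intersecting_def
  proof (intro conjI ballI)
    show "U \<subseteq> Pow {..<n}" by (auto simp: U_def leaf_upset_def)
    show "\<forall>Y Z. Y \<in> U \<longrightarrow> Y \<subseteq> Z \<longrightarrow> Z \<subseteq> {..<n} \<longrightarrow> Z \<in> U" by (auto simp: U_def leaf_upset_def)
    show "Y \<inter> Z \<noteq> {}" if "Y \<in> U" "Z \<in> U" for Y Z
      using that common unfolding U_def leaf_upset_def by blast
  qed
  then have U0: "U \<subseteq> Pow {..<n}" "{} \<notin> U" by (auto simp: intersecting_upset_def intersecting_def)
  have "F \<subseteq> upset_family n r U"
  proof
    fix S assume S: "S \<in> F"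
    show "S \<in> upset_family n r U"
    proof (cases "Root \<in> S")
      case True
      have e: "rooted (leaves S) = S" using True S F rooted_leaves by blast
      then have "leaves S \<subseteq> {..<n}" "card (leaves S) = r - 1"
        using S F rooted_in_claw_sets_iff[OF r(1)] by (metis subsetD)+
      moreover have "{..<n} - leaves S \<notin> U"
        using common[OF _ S] by (auto simp: U_def leaf_upset_def)
      ultimately show ?thesis using e unfolding upset_family_def by blast
    next
      case False
      then have e: "signed (leaves S) (mids S) = S" by (rule signed_leaves_mids)
      then have s: "leaves S \<subseteq> {..<n}" "mids S \<subseteq> {..<n} - leaves S" "card (leaves S) + card (mids S) = r"
        using S F signed_in_claw_sets_iff by (metis subsetD)+
      then have "leaves S \<in> U" using S False by (auto simp: U_def leaf_upset_def)
      then have "(leaves S, mids S) \<in> signed_index n r U" using s by (auto simp: signed_index_def)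
      then have "(\<lambda>(P, M). signed P M) (leaves S, mids S) \<in> upset_family n r U" unfolding upset_family_def by blast
      then show ?thesis using e by simp
    qed
  qed
  moreover have "finite (upset_family n r U)"
  proof -
    have "upset_family n r U \<subseteq> claw_sets n r"
      using U0 r by (auto simp: upset_family_def signed_index_def signed_in_claw_sets_iff rooted_in_claw_sets_iff)
    then show ?thesis using finite_claw_sets finite_subset by blast
  qed
  ultimately have "int (card F) \<le> int (card (upset_family n r U))" by (simp add: card_mono)
  then have le: "int (card F) \<le> claw_val n r (level U) + int (n choose (r - 1))"
    using card_upset_family[OF U0 r] by simp
  then show "int (card F) \<le> star_size n r"
    using claw_val_level_le(1)[OF U r] by (simp add: star_size_def)
  assume r2: "2 \<le> r" and eq: "int (card F) = star_size n r"
  have "claw_val n r (level U) = claw_val n r (\<lambda>j. (n - 1) choose (j - 1))"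
    using le eq claw_val_level_le(1)[OF U r] unfolding star_size_def by linarith
  then have "1 \<le> level U 1" by (rule claw_val_level_le(2)[OF U r r2])
  then have "{Y \<in> U. card Y = 1} \<noteq> {}" unfolding level_def by (metis card.empty not_one_le_zero)
  \<comment> \<open>A singleton in \<open>U\<close> comes from a rootless member with no leaf other
    than \<open>Leaf x\<close>; sharing a leaf with it means containing
    \<open>Leaf x\<close>.\<close>
  then obtain x where x: "{x} \<in> U" by (auto simp: card_1_singleton_iff)
  then obtain S0 where S0: "S0 \<in> F" "Root \<notin> S0" "leaves S0 \<subseteq> {x}" and xn: "x < n"
    by (auto simp: U_def leaf_upset_def)
  have "F \<subseteq> star_family (claw_V n) (claw_E n) r (Leaf x)"
  proof
    fix S assume "S \<in> F"
    then have "x \<in> leaves S" using common[OF S0(1), of S] S0 by auto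
    then show "S \<in> star_family (claw_V n) (claw_E n) r (Leaf x)"
      using \<open>S \<in> F\<close> F by (auto simp: star_family_def leaves_def)
  qed
  moreover have "card F = card (star_family (claw_V n) (claw_E n) r (Leaf x))"
    using card_star_Leaf[OF xn r] eq by simp
  moreover have "finite (star_family (claw_V n) (claw_E n) r (Leaf x))"
    by (rule finite_subset[OF _ finite_claw_sets]) (auto simp: star_family_def)
  ultimately show "\<exists>x<n. F = star_family (claw_V n) (claw_E n) r (Leaf x)"
    using xn card_subset_eq by blast
qed

text \<open>If a shift at \<open>x\<close> produced the star of the leaf at \<open>x\<close>, then for each rest \<open>Q\<close> exactly one of
  \<open>Q \<union> {Mid x}\<close>, \<open>Q \<union> {Leaf x}\<close> is in the family, and the choice is the same for disjoint rests.
  Two such steps replace a leaf of \<open>Q\<close> by a fresh middle vertex.\<close>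

lemma shift_eq_star_imp_eq:
  assumes F: "F \<subseteq> claw_sets n r" "intersecting F" and r: "2 \<le> r" "r < n" and x: "x < n"
    and star: "shift i F = star_family (claw_V n) (claw_E n) r (Leaf x)"
  shows "F = star_family (claw_V n) (claw_E n) r (Leaf x)"
proof -
  let ?St = "star_family (claw_V n) (claw_E n) r (Leaf x)"
  have img: "shift_set i F S \<in> ?St" if "S \<in> F" for S using star that by (auto simp: shift_def)
  have "F \<subseteq> ?St"
  proof (rule ccontr)
    assume "\<not> F \<subseteq> ?St"
    then obtain S0 where S0: "S0 \<in> F" "Leaf x \<notin> S0" using F by (auto simp: star_family_def)
    \<comment> \<open>All images contain \<open>Leaf x\<close>, and a member can gain it only by
      being moved at \<open>x\<close>.\<close>
    have moved: "i = x \<and> Mid x \<in> S" if "S \<in> F" "Leaf x \<notin> S" for S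
    proof -
      have "Leaf x \<in> shift_set i F S" using img[OF that(1)] by (simp add: star_family_def)
      moreover from this have ne: "shift_set i F S \<noteq> S" using that by blast
      ultimately show ?thesis using shift_set_moved(1,2)[OF that(1) ne] that by simp
    qed
    have ix: "i = x" using moved[OF S0] by simp
    have pre: "insert (Mid x) (T - {Leaf x}) \<in> F" if T: "T \<in> ?St" "T \<notin> F" for T
    proof -
      have "T \<in> shift_set x F ` F" using T(1) unfolding star[symmetric] shift_def ix .
      then obtain S where S: "S \<in> F" "shift_set x F S = T" by blast
      then have ne: "shift_set x F S \<noteq> S" using T by auto
      have "Leaf x \<notin> S" using shift_set_moved(1)[OF S(1) ne] F S by (auto simp: claw_sets_iff)
      then have "insert (Mid x) (T - {Leaf x}) = S"
        using shift_set_moved(1,2)[OF S(1) ne] S by auto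
      then show ?thesis using S by simp
    qed
    \<comment> \<open>A set of the star disjoint from a member of \<open>F\<close> is not in
      \<open>F\<close>, so it arose by moving its version with \<open>Mid x\<close>.\<close>
    have swap: "insert (Mid x) (T - {Leaf x}) \<in> F" if T: "T \<in> ?St" "S \<in> F" "S \<inter> T = {}" for S T
      using pre[OF T(1)] T F by (auto simp: intersecting_def)
    have "\<exists>S\<in>F. Mid x \<in> S \<and> leaves S = {}"
    proof -
      \<comment> \<open>A member with \<open>Mid x\<close> and the fewest leaves is shown to have
        none; a fresh index \<open>y\<close> exists because \<open>r < n\<close>.\<close>
      define k where "k = (LEAST k. \<exists>S\<in>F. Mid x \<in> S \<and> card (leaves S) = k)"
      have "\<exists>S\<in>F. Mid x \<in> S \<and> card (leaves S) = k"
        unfolding k_def by (rule LeastI_ex) (use S0 moved in blast)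
      then obtain S where S: "S \<in> F" "Mid x \<in> S" "card (leaves S) = k" by blast
      have SI: "S \<in> claw_sets n r" using S F by auto
      have R: "Root \<notin> S" using S SI by (auto simp: claw_sets_iff)
      have Seq: "S = signed (leaves S) (mids S)" using signed_leaves_mids[OF R] by simp
      have s: "leaves S \<subseteq> {..<n}" "mids S \<subseteq> {..<n} - leaves S" "card (leaves S) + card (mids S) = r"
        using SI Seq signed_in_claw_sets_iff by metis+
      have fin: "finite (leaves S)" "finite (mids S)" using s finite_subset by blast+
      have xS: "x \<in> mids S" "x \<notin> leaves S" using S SI by (auto simp: mids_def leaves_def claw_sets_iff)
      have "leaves S = {}"
      proof (rule ccontr)
        assume "leaves S \<noteq> {}"
        then obtain a where a: "a \<in> leaves S" by blast
        have "card (leaves S \<union> mids S) < n"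
          using s r card_Un_le[of "leaves S" "mids S"] by linarith
        then obtain y where y: "y < n" "y \<notin> leaves S" "y \<notin> mids S"
          using card_mono[of "leaves S \<union> mids S" "{..<n}"] fin by force
        \<comment> \<open>Exchanging the roles of leaves and middle vertices makes \<open>T1\<close>
          disjoint from \<open>S\<close> and puts \<open>Leaf x\<close> into it.\<close>
        define T1 where "T1 = signed (mids S) (leaves S)"
        have T1: "T1 \<in> ?St"
          using s xS by (auto simp: star_family_def T1_def signed_in_claw_sets_iff)
        have "S \<inter> T1 = {}"
          by (subst Seq) (use s in \<open>auto simp: T1_def signed_def\<close>)
        then have S1: "insert (Mid x) (T1 - {Leaf x}) \<in> F" using swap[OF T1 S(1)] by blast
        \<comment> \<open>\<open>T2\<close> avoids the modified \<open>T1\<close>; after the second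
          swap it is \<open>S\<close> with \<open>Leaf a\<close> replaced by \<open>Mid y\<close>,
          which has one leaf fewer.\<close>
        define T2 where "T2 = signed (insert x (leaves S - {a})) (insert y (mids S - {x}))"
        have "card (insert x (leaves S - {a})) = card (leaves S)"
          using a xS fin by (intro card_exchange)
        moreover have "card (insert y (mids S - {x})) = card (mids S)"
          using y xS fin by (intro card_exchange)
        ultimately have "T2 \<in> claw_sets n r"
          unfolding T2_def signed_in_claw_sets_iff using s x xS y by auto
        then have T2: "T2 \<in> ?St" by (simp add: star_family_def T2_def)
        have "insert (Mid x) (T1 - {Leaf x}) \<inter> T2 = {}"
          using s y xS by (auto simp: T1_def T2_def signed_def)
        then have S2: "insert (Mid x) (T2 - {Leaf x}) \<in> F" using swap[OF T2 S1] by blast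
        have "leaves (insert (Mid x) (T2 - {Leaf x})) = leaves S - {a}"
          using xS by (auto simp: T2_def leaves_def signed_def)
        then have "card (leaves (insert (Mid x) (T2 - {Leaf x}))) < k"
          using a S(3) fin by (metis card_Diff1_less)
        moreover have "k \<le> card (leaves (insert (Mid x) (T2 - {Leaf x})))"
          unfolding k_def by (rule Least_le) (use S2 in blast)
        ultimately show False by simp
      qed
      then show ?thesis using S by blast
    qed
    then obtain S where S: "S \<in> F" "Mid x \<in> S" "leaves S = {}" by blast
    \<comment> \<open>A rooted set in the star cannot be the image of a moved set, because
      \<open>Root\<close> and \<open>Mid x\<close> are adjacent. Hence it lies in \<open>F\<close>,
      yet it misses \<open>S\<close>, which has neither leaves nor the root. The size
      \<open>r - 2\<close> leaves room for \<open>Root\<close> and \<open>Leaf x\<close>.\<close>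
    have "r - 2 \<le> card ({..<n} - {x})" using r x by simp
    then obtain L where L: "L \<subseteq> {..<n} - {x}" "card L = r - 2" by (metis obtain_subset_with_card_n)
    then have finL: "finite L" using finite_subset by blast
    have "rooted (insert x L) \<in> claw_sets n r"
      using L finL r x by (subst rooted_in_claw_sets_iff) (auto simp: card_insert_if)
    then have T: "rooted (insert x L) \<in> ?St" by (simp add: star_family_def)
    have "rooted (insert x L) \<in> F"
    proof (rule ccontr)
      assume "rooted (insert x L) \<notin> F"
      then have "insert (Mid x) (rooted (insert x L) - {Leaf x}) \<in> claw_sets n r" using pre[OF T] F by auto
      then show False by (auto simp: claw_sets_iff rooted_def)
    qed
    then have "S \<inter> rooted (insert x L) \<noteq> {}" using S F by (auto simp: intersecting_def)
    moreover have "Root \<notin> S" using S F by (auto simp: claw_sets_iff)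
    ultimately show False using S by (auto simp: rooted_def leaves_def)
  qed
  moreover have "card F = card ?St" using card_shift[OF F(1), of i] star by simp
  moreover have "finite ?St"
    by (rule finite_subset[OF _ finite_claw_sets]) (auto simp: star_family_def)
  ultimately show ?thesis using card_subset_eq by blast
qed

section \<open>Arbitrary intersecting families\<close>

text \<open>Induction on \<open>mid_count\<close>: compress while some compression changes the
  family, then carry the equality case back through each compression by
  \<open>shift_eq_star_imp_eq\<close>.\<close>

lemma intersecting_claw_bound:
  assumes "F \<subseteq> claw_sets n r" "intersecting F" and r: "1 \<le> r" "r < n"
  shows "int (card F) \<le> star_size n r \<and> (2 \<le> r \<longrightarrow> int (card F) = star_size n r \<longrightarrow>
      (\<exists>x<n. F = star_family (claw_V n) (claw_E n) r (Leaf x)))"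
  using assms(1,2)
proof (induction "mid_count F" arbitrary: F rule: less_induct)
  case less
  show ?case
  proof (cases "\<forall>i. shift i F = F")
    case True
    then show ?thesis using shift_fixed_bound[OF less.prems _ r] by blast
  next
    case False
    then obtain i where i: "shift i F \<noteq> F" by blast
    have IH: "int (card (shift i F)) \<le> star_size n r \<and> (2 \<le> r \<longrightarrow> int (card (shift i F)) = star_size n r \<longrightarrow>
      (\<exists>x<n. shift i F = star_family (claw_V n) (claw_E n) r (Leaf x)))"
      using less.prems i
      by (intro less.hyps mid_count_shift_less shift_subset intersecting_shift)
    then show ?thesis
      using card_shift[OF less.prems(1)] shift_eq_star_imp_eq[OF less.prems _ r(2)] by metis
  qed
qed

theorem theorem9p3:
  fixes n r :: nat
  assumes "1 \<le> r" and "r \<le> n - 1"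
  shows "r_EKR (claw_V n) (claw_E n) r \<and>
         (4 \<le> r \<and> r < n - 1 \<longrightarrow> strictly_r_EKR (claw_V n) (claw_E n) r)"
proof -
  have r: "1 \<le> r" "r < n" using assms by auto
  let ?N = "nat (star_size n r)"
  have star0: "card (star_family (claw_V n) (claw_E n) r (Leaf x)) = ?N" if "x < n" for x
    using card_star_Leaf[OF that r] by simp
  have bound: "card F \<le> ?N" if "F \<subseteq> claw_sets n r" "intersecting F" for F
    using intersecting_claw_bound[OF that r] by linarith
  have st: "star_family (claw_V n) (claw_E n) r v \<subseteq> claw_sets n r"
    "intersecting (star_family (claw_V n) (claw_E n) r v)" for v
    by (auto simp: star_family_def intersecting_def)
  have "max_intersecting_size (claw_V n) (claw_E n) r = ?N"
    unfolding max_intersecting_size_def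
  proof (rule Max_eqI)
    show "finite {card F |F. F \<subseteq> claw_sets n r \<and> intersecting F}"
      by (rule finite_subset[of _ "{..?N}"]) (use bound in auto)
    \<comment> \<open>The maximum is attained by the star of \<open>Leaf 0\<close>, which exists as
      \<open>n > r \<ge> 1\<close>.\<close>
    show "?N \<in> {card F |F. F \<subseteq> claw_sets n r \<and> intersecting F}"
      using star0[of 0, symmetric] st[of "Leaf 0"] r unfolding mem_Collect_eq by blast
  qed (use bound in auto)
  moreover have "max_star_size (claw_V n) (claw_E n) r = ?N"
    unfolding max_star_size_def
  proof (rule Max_eqI)
    show "finite {card (star_family (claw_V n) (claw_E n) r v) |v. v \<in> claw_V n}"
      using finite_claw_V by simp
    have "Leaf 0 \<in> claw_V n" using r by (auto simp: claw_V_def)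
    then show "?N \<in> {card (star_family (claw_V n) (claw_E n) r v) |v. v \<in> claw_V n}"
      using star0[of 0, symmetric] r unfolding mem_Collect_eq by blast
  qed (use bound st in auto)
  moreover have "\<exists>v\<in>claw_V n. F = star_family (claw_V n) (claw_E n) r v"
    if F: "F \<subseteq> claw_sets n r" "intersecting F" "card F = ?N" and r2: "2 \<le> r" for F
  proof -
    \<comment> \<open>Nonnegativity makes the conversion by \<open>nat\<close> in \<open>?N\<close>
      reversible.\<close>
    have "0 \<le> star_size n r" using card_star_Leaf[of 0 n r] r by linarith
    then have "int (card F) = star_size n r" using F(3) by simp
    then obtain x where "x < n" "F = star_family (claw_V n) (claw_E n) r (Leaf x)"
      using intersecting_claw_bound[OF F(1,2) r] r2 by blast
    then show ?thesis by (auto simp: claw_V_def)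
  qed
  ultimately show ?thesis by (auto simp: r_EKR_def strictly_r_EKR_def)
qed

end
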